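(* Let $(\lambda^k)$ be the (random) iterates of the SGSL-CD algorithm applied to $F$. Then SGSL-CD converges as $$\mathbb{E}\left[F(\lambda^{k+1})\mid\lambda^k\right]-F(\lambda^* )\;\le\;\left(1-\frac{\sigma_{\mathrm{SML}}}{n}\right)\left[F(\lambda^k)-F(\lambda^* )\right],$$ and it holds that $$\frac{\sigma_{\mathrm{SM}}}{L}\;\le\;\sigma_{\mathrm{SML}} .$$
   Context: Setting. $\mathcal{G}=(\mathcal V,\mathcal E)$ is a finite undirected graph with $n=|\mathcal V|$ nodes and $E=|\mathcal E|$ edges; $\ell\equiv(i,j)$ means that edge $\ell$ joins nodes $i$ and $j$. $A\in\mathbb{R}^{n\times E}$ is the incidence matrix: column $\ell\equiv(i,j)$ has one entry $1$ and one entry $-1$, in rows $i$ and $j$ (the sign choice is irrelevant), and zeros elsewhere. For $i=1,\dots,n$, $f_i:\mathbb{R}\to\mathbb{R}$ is $M_i$-smooth and $\mu_i$-strongly convex, i.e. there are constants $M_i\ge\mu_i>0$ such that for all $x,y$: $f_i(x)+f_i'(x)(y-x)+\frac{\mu_i}{2}(y-x)^2\le f_i(y)\le f_i(x)+f_i'(x)(y-x)+\frac{M_i}{2}(y-x)^2$. Put $\mu_{\min}=\min_i\mu_i$. $f_i^*(y)=\sup_{x\in\mathbb{R}}(yx-f_i(x))$ is the Fenchel conjugate, and $F:\mathbb{R}^E\to\mathbb{R}$ is $F(\lambda)=\sum_{i=1}^n f_i^*(u_i^TA\lambda)$, with $u_i$ the $i$-th standard basis vector of $\mathbb{R}^n$.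 $\lambda^*$ is a minimizer of $F$. $\nabla_\ell F=\partial F/\partial\lambda_\ell$ and $e_\ell$ is the $\ell$-th standard basis vector of $\mathbb{R}^E$. $L=\gamma_{\max}/\mu_{\min}$, with $\gamma_{\max}$ the largest eigenvalue of $A^TA$; $F$ is $L$-smooth. $\mathcal S_i$ is the set of edges incident to node $i$. $L_\ell\le L$ ($\ell=1,\dots,E$) are the coordinate-wise smoothness constants of $F$: $|\nabla_\ell F(\lambda+\alpha e_\ell)-\nabla_\ell F(\lambda)|\le L_\ell|\alpha|$ for $\alpha\in\mathbb{R}$. Norms on $\mathbb{R}^E$: $\|x\|_{\mathrm{SM}}=\sqrt{\sum_{i=1}^n\max_{\ell\in\mathcal S_i}x_\ell^2}$ and $\|x\|_{\mathrm{SML}}=\sqrt{\sum_{i=1}^n\max_{\ell\in\mathcal S_i}\left(\frac1{L_\ell}x_\ell^2\right)}$; their dual norms are $\|z\|^*_{\bullet}=\sup\{z^Tx:\|x\|_{\bullet}\le1\}$. $\sigma_{\mathrm{SM}}$ and $\sigma_{\mathrm{SML}}$ denote the strong convexity constants of $F$ in $\|\cdot\|_{\mathrm{SM}}^*$ and $\|\cdot\|_{\mathrm{SML}}^*$ respectively, i.e. the constants in $F(y)\ge F(x)+\langle\nabla F(x),y-x\rangle+\frac{\sigma_{\bullet}}{2}(\|y-x\|_{\bullet}^* )^2$ for $\bullet=\mathrm{SM},\mathrm{SML}$. SGSL-CD (Setwise Gauss-Southwell Lipschitz Coordinate Descent): at each iteration $k$ a node $i$ is drawn uniformly from $\{1,\dots,n\}$;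 then $\ell=\arg\max_{m\in\mathcal S_i}|\nabla_mF(\lambda^k)|/\sqrt{L_m}$ is chosen and $\lambda^{k+1}=\lambda^k-\frac1{L_\ell}\nabla_\ell F(\lambda^k)e_\ell$. *)

theory Defs
  imports "HOL-Probability.Probability"
begin

text \<open>
  The finite types \<open>'v\<close> and \<open>'e\<close> index the nodes and the edges of the graph. An undirected
  edge \<open>l\<close> is given by the set \<open>ends l\<close> of the two nodes it joins; parallel edges are not excluded.
\<close>

definition incident_edges :: "('e \<Rightarrow> 'v set) \<Rightarrow> 'v \<Rightarrow> 'e set" where
  "incident_edges ends i = {l. i \<in> ends l}"

text \<open>A relation and not a function, since the sign of each column may be chosen freely.\<close>

definition is_incidence_matrix :: "('e::finite \<Rightarrow> 'v::finite set) \<Rightarrow> real^'e^'v \<Rightarrow> bool" where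
  "is_incidence_matrix ends A \<longleftrightarrow>
     (\<forall>l. \<exists>i j. i \<noteq> j \<and> ends l = {i, j} \<and> A $ i $ l = 1 \<and> A $ j $ l = -1 \<and>
            (\<forall>k. k \<notin> {i, j} \<longrightarrow> A $ k $ l = 0))"

definition smooth_strongly_convex :: "real \<Rightarrow> real \<Rightarrow> (real \<Rightarrow> real) \<Rightarrow> bool" where
  "smooth_strongly_convex Ms \<mu> g \<longleftrightarrow>
     0 < \<mu> \<and> \<mu> \<le> Ms \<and> (\<forall>x. g differentiable at x) \<and>
     (\<forall>x y. g x + deriv g x * (y - x) + \<mu> / 2 * (y - x)\<^sup>2 \<le> g y \<and>
            g y \<le> g x + deriv g x * (y - x) + Ms / 2 * (y - x)\<^sup>2)"

text \<open>
  For a strongly convex function the supremum is over a nonempty set that is bounded above, so the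
  real-valued supremum is the genuine one.
\<close>

definition fenchel_conjugate :: "(real \<Rightarrow> real) \<Rightarrow> real \<Rightarrow> real" where
  "fenchel_conjugate g y = (SUP x. y * x - g x)"

definition dual_objective :: "('v::finite \<Rightarrow> real \<Rightarrow> real) \<Rightarrow> real^'e^'v \<Rightarrow> real^'e::finite \<Rightarrow> real" where
  "dual_objective f A lam = (\<Sum>i\<in>UNIV. fenchel_conjugate (f i) ((A *v lam) $ i))"

definition partial_deriv :: "'e \<Rightarrow> (real^'e \<Rightarrow> real) \<Rightarrow> real^'e::finite \<Rightarrow> real" where
  "partial_deriv l F x = deriv (\<lambda>t. F (x + t *\<^sub>R axis l 1)) 0"

definition grad :: "(real^'e \<Rightarrow> real) \<Rightarrow> real^'e::finite \<Rightarrow> real^'e" where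
  "grad F x = (\<chi> l. partial_deriv l F x)"

definition eigenvalues :: "real^'e^'e::finite \<Rightarrow> real set" where
  "eigenvalues B = {c. \<exists>v. v \<noteq> 0 \<and> B *v v = c *s v}"

definition smoothness_const :: "real^'e::finite^'v::finite \<Rightarrow> ('v \<Rightarrow> real) \<Rightarrow> real" where
  "smoothness_const A \<mu> = Max (eigenvalues (transpose A ** A)) / Min (range \<mu>)"

definition coordinatewise_smooth :: "('e \<Rightarrow> real) \<Rightarrow> (real^'e \<Rightarrow> real) \<Rightarrow> bool" where
  "coordinatewise_smooth Lc F \<longleftrightarrow>
     (\<forall>l::'e::finite. \<forall>x \<alpha>.
        \<bar>partial_deriv l F (x + \<alpha> *\<^sub>R axis l 1) - partial_deriv l F x\<bar> \<le> Lc l * \<bar>\<alpha>\<bar>)"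

text \<open>A maximum over the empty set (a node without edges) counts as \<open>0\<close>.\<close>

definition norm_SM :: "('v::finite \<Rightarrow> 'e set) \<Rightarrow> real^'e::finite \<Rightarrow> real" where
  "norm_SM S x = sqrt (\<Sum>i\<in>UNIV. if S i = {} then 0 else MAX l\<in>S i. (x $ l)\<^sup>2)"

definition norm_SML :: "('v::finite \<Rightarrow> 'e set) \<Rightarrow> ('e \<Rightarrow> real) \<Rightarrow> real^'e::finite \<Rightarrow> real" where
  "norm_SML S Lc x = sqrt (\<Sum>i\<in>UNIV. if S i = {} then 0 else MAX l\<in>S i. 1 / Lc l * (x $ l)\<^sup>2)"

definition dual_norm :: "(real^'e \<Rightarrow> real) \<Rightarrow> real^'e::finite \<Rightarrow> real" where
  "dual_norm N z = Sup {z \<bullet> x | x. N x \<le> 1}"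

text \<open>
  The largest admissible constant. For a norm \<open>N\<close> on a nontrivial space the set is closed and
  bounded above, and it contains \<open>0\<close> when \<open>F\<close> is convex and differentiable, so the supremum is
  attained and nonnegative. It is \<open>0\<close> if \<open>F\<close> is not strongly convex, e.g. if the graph has a cycle.
\<close>

definition strong_convexity_const :: "(real^'e \<Rightarrow> real) \<Rightarrow> (real^'e::finite \<Rightarrow> real) \<Rightarrow> real" where
  "strong_convexity_const F N =
     Sup {\<sigma>. \<forall>x y. F y \<ge> F x + grad F x \<bullet> (y - x) + \<sigma> / 2 * (N (y - x))\<^sup>2}"

text \<open>
  \<open>node k\<close> is the node drawn and \<open>edge k\<close> the edge chosen at iteration \<open>k\<close>, and \<open>lam k\<close> is the
  iterate, started at the point \<open>lam0\<close>. Each draw is uniform and independent of all earlier draws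
  and choices. Ties in the argmax may be broken in any way, also at random or depending on the
  history. A node without edges leaves the iterate unchanged.
\<close>

definition sgsl_cd ::
  "'a measure \<Rightarrow> ('v::finite \<Rightarrow> 'e set) \<Rightarrow> ('e \<Rightarrow> real) \<Rightarrow> (real^'e \<Rightarrow> real) \<Rightarrow> real^'e::finite \<Rightarrow>
   (nat \<Rightarrow> 'a \<Rightarrow> 'v) \<Rightarrow> (nat \<Rightarrow> 'a \<Rightarrow> 'e) \<Rightarrow> (nat \<Rightarrow> 'a \<Rightarrow> real^'e) \<Rightarrow> bool" where
  "sgsl_cd P S Lc F lam0 node edge lam \<longleftrightarrow>
     prob_space P \<and>
     (\<forall>k. node k \<in> P \<rightarrow>\<^sub>M count_space UNIV) \<and>
     (\<forall>k. edge k \<in> P \<rightarrow>\<^sub>M count_space UNIV) \<and>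
     (\<forall>k. distr P (count_space UNIV) (node k) = uniform_count_measure UNIV) \<and>
     (\<forall>k. prob_space.indep_set P
            (sets (vimage_algebra (space P)
               (\<lambda>\<omega>. map (\<lambda>j. (node j \<omega>, edge j \<omega>)) [0..<k]) (count_space UNIV)))
            (sets (vimage_algebra (space P) (node k) (count_space UNIV)))) \<and>
     (\<forall>\<omega>\<in>space P. lam 0 \<omega> = lam0) \<and>
     (\<forall>k. \<forall>\<omega>\<in>space P.
        if S (node k \<omega>) = {} then lam (Suc k) \<omega> = lam k \<omega>
        else is_arg_max (\<lambda>m. \<bar>partial_deriv m F (lam k \<omega>)\<bar> / sqrt (Lc m))
               (\<lambda>m. m \<in> S (node k \<omega>)) (edge k \<omega>) \<and>
             lam (Suc k) \<omega> = lam k \<omega> -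
               (1 / Lc (edge k \<omega>) * partial_deriv (edge k \<omega>) F (lam k \<omega>)) *\<^sub>R axis (edge k \<omega>) 1)"

end

theory Submission
  imports Defs
begin

text \<open>
  The objective is a sum of conjugates of strongly convex functions, composed with the incidence
  matrix. Each conjugate is convex and differentiable with strictly increasing derivative
  (\<open>fenchel_conjugate_derivative\<close>). So \<open>F\<close> is convex, has all partial derivatives, and its coordinate
  constants are positive (\<open>dual_objective_convex\<close>, \<open>coordinate_constant_pos\<close>).

  A step along edge \<open>l\<close> with step size \<open>1 / Lc l\<close> decreases \<open>F\<close> by at least half of
  \<open>1 / Lc l * (partial_deriv l F x)\<^sup>2\<close> (\<open>coordinate_descent_step\<close>). The selection rule maximizes exactly
  this quantity among the edges at the drawn node. The draw is uniform and independent of the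
  current iterate, so the expected decrease is the average over all nodes
  (\<open>real_cond_exp_uniform_choice\<close>). The sum over the nodes of these maxima is by definition the square
  of \<open>norm_SML S Lc\<close> at the gradient. In expectation, \<open>F\<close> thus decreases by at least that square over
  twice the number of nodes. Strong convexity with respect to the dual of this norm, evaluated at the
  minimizer, bounds the squared gradient norm from below by twice \<open>\<sigma>_SML\<close> times the suboptimality gap
  (\<open>gradient_dominance\<close>), which gives the contraction factor.

  For the comparison of the constants, \<open>Lc l \<le> L\<close> makes \<open>norm_SM S\<close> at most \<open>sqrt L * norm_SML S Lc\<close>.
  Passing to dual norms reverses the inequality, so an admissible constant for the
  former, divided by \<open>L\<close>, is admissible for the latter (\<open>strong_convexity_const_le_if_gauge_le\<close>).
\<close>

section \<open>Conjugates of strongly convex functions\<close>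

lemma smooth_strongly_convexD:
  assumes "smooth_strongly_convex Ms m g"
  shows "g x + deriv g x * (y - x) + m / 2 * (y - x)\<^sup>2 \<le> g y" "0 < m"
    "(g has_real_derivative deriv g x) (at x)"
  using assms
  by (auto simp: smooth_strongly_convex_def DERIV_deriv_iff_real_differentiable)

text \<open>
  Quadratic growth confines the search for a maximizer of \<open>y * z - g z\<close> to a compact interval.
  Hence the supremum that defines the conjugate is attained, at a point of slope \<open>y\<close>.
\<close>

lemma fenchel_maximizer_ex:
  assumes g: "smooth_strongly_convex Ms m g"
  shows "\<exists>x. deriv g x = y \<and> (\<forall>z. y * z - g z \<le> y * x - g x)"
proof -
  note m = smooth_strongly_convexD[OF g]
  define h where "h = (\<lambda>z. g z - y * z)"
  define R where "R = 2 * \<bar>deriv g 0 - y\<bar> / m"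
  have R0: "0 \<le> R" using m(2) by (simp add: R_def)
  have "isCont h z" for z
    unfolding h_def using DERIV_isCont[OF m(3)] by (intro continuous_intros) auto
  then have "continuous_on {-R..R} h"
    by (intro continuous_at_imp_continuous_on) simp
  then obtain x where x: "x \<in> {-R..R}" "\<And>z. z \<in> {-R..R} \<Longrightarrow> h x \<le> h z"
    using continuous_attains_inf[of "{-R..R}" h] R0 by auto
  have min: "h x \<le> h z" for z
  proof (cases "z \<in> {-R..R}")
    case False
    \<comment> \<open>Outside the interval the quadratic growth beats the slope at \<open>0\<close>.\<close>
    then have "R \<le> \<bar>z\<bar>" by auto
    then have "\<bar>deriv g 0 - y\<bar> \<le> m / 2 * \<bar>z\<bar>"
      using m(2) by (simp add: R_def field_simps)
    then have "\<bar>deriv g 0 - y\<bar> * \<bar>z\<bar> \<le> m / 2 * \<bar>z\<bar> * \<bar>z\<bar>"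
      by (rule mult_right_mono) simp
    then have "\<bar>(deriv g 0 - y) * z\<bar> \<le> m / 2 * z\<^sup>2"
      by (simp add: abs_mult power2_eq_square)
    moreover have "h 0 + (deriv g 0 - y) * z + m / 2 * z\<^sup>2 \<le> h z"
      using m(1)[of 0 z] by (simp add: h_def algebra_simps)
    ultimately have "h 0 \<le> h z" by linarith
    then show ?thesis using x(2)[of 0] R0 by simp
  qed (rule x(2))
  have "(h has_real_derivative deriv g x - y) (at x)"
    unfolding h_def by (auto intro!: derivative_eq_intros m(3))
  then have "deriv g x - y = 0"
    by (rule DERIV_local_min[of _ _ _ 1]) (simp_all add: min)
  moreover have "y * z - g z \<le> y * x - g x" for z
    using min[of z] by (simp add: h_def)
  ultimately show ?thesis by auto
qed

text \<open>
  The derivative of the conjugate at \<open>y\<close> is the maximizer \<open>p y\<close> of \<open>y * x - g x\<close> over \<open>x\<close>. The maximizer gives a supporting line of the conjugate at each point. Strong convexity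
  of \<open>g\<close> makes \<open>p\<close> Lipschitz, so the supporting lines at two near points differ to second order
  only, which is differentiability. Strong convexity also makes \<open>p\<close> monotone, and strictly so because
  it has the left inverse \<open>deriv g\<close>.
\<close>

lemma fenchel_conjugate_derivative:
  assumes g: "smooth_strongly_convex Ms m g"
  shows "(fenchel_conjugate g has_real_derivative deriv (fenchel_conjugate g) y) (at y)"
    and "fenchel_conjugate g y + deriv (fenchel_conjugate g) y * (z - y) \<le> fenchel_conjugate g z"
    and "strict_mono (deriv (fenchel_conjugate g))"
proof -
  note m = smooth_strongly_convexD[OF g]
  obtain p where p: "\<And>y. deriv g (p y) = y" "\<And>y z. y * z - g z \<le> y * p y - g (p y)"
    using fenchel_maximizer_ex[OF g] by metis
  have val: "fenchel_conjugate g y = y * p y - g (p y)" for y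
    unfolding fenchel_conjugate_def by (rule cSup_eq_maximum) (auto simp: p)
  have conv: "fenchel_conjugate g y + p y * (z - y) \<le> fenchel_conjugate g z" for y z
    using p(2)[where y = z and z = "p y"] by (simp add: val algebra_simps)
  have strong: "m * (p y - p z)\<^sup>2 \<le> (y - z) * (p y - p z)" for y z
    using m(1)[of "p y" "p z"] m(1)[of "p z" "p y"]
    by (simp add: p algebra_simps power2_eq_square)
  have lip: "m * \<bar>p y - p z\<bar> \<le> \<bar>y - z\<bar>" for y z
  proof (cases "p y = p z")
    case False
    have "m * \<bar>p y - p z\<bar> * \<bar>p y - p z\<bar> \<le> \<bar>y - z\<bar> * \<bar>p y - p z\<bar>"
      using strong[of y z] abs_ge_self[of "(y - z) * (p y - p z)"]
      by (simp add: power2_eq_square abs_mult mult.assoc)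
    with False show ?thesis by simp
  qed simp
  have der: "(fenchel_conjugate g has_real_derivative p y) (at y)" for y
  proof -
    have "((\<lambda>z. (fenchel_conjugate g z - fenchel_conjugate g y) / (z - y) - p y) \<longlongrightarrow> 0) (at y)"
    proof (rule Lim_null_comparison)
      show "((\<lambda>z. \<bar>z - y\<bar> / m) \<longlongrightarrow> 0) (at y)"
        using m(2) by (auto intro!: tendsto_eq_intros)
      have "\<bar>(fenchel_conjugate g z - fenchel_conjugate g y) / (z - y) - p y\<bar> \<le> \<bar>z - y\<bar> / m"
        if "z \<noteq> y" for z
      proof -
        \<comment> \<open>The gap to the supporting line at \<open>y\<close> is bounded by means of the supporting line at \<open>z\<close>.\<close>
        let ?d = "fenchel_conjugate g z - fenchel_conjugate g y - p y * (z - y)"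
        have "0 \<le> ?d" using conv[of y z] by simp
        moreover have "?d \<le> (p z - p y) * (z - y)" using conv[of z y] by (simp add: algebra_simps)
        ultimately have "\<bar>?d\<bar> \<le> \<bar>p z - p y\<bar> * \<bar>z - y\<bar>"
          using abs_ge_self[of "(p z - p y) * (z - y)"] by (simp only: abs_mult abs_of_nonneg)
        then have "\<bar>?d\<bar> / \<bar>z - y\<bar> \<le> \<bar>p z - p y\<bar>"
          using that by (simp add: field_simps)
        moreover have "(fenchel_conjugate g z - fenchel_conjugate g y) / (z - y) - p y = ?d / (z - y)"
          using that by (simp add: field_simps)
        moreover have "\<bar>p z - p y\<bar> \<le> \<bar>z - y\<bar> / m"
          using lip[of z y] m(2) by (simp add: field_simps)
        ultimately show ?thesis by (simp add: abs_divide)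
      qed
      then show "\<forall>\<^sub>F z in at y. norm ((fenchel_conjugate g z - fenchel_conjugate g y) / (z - y) - p y)
          \<le> \<bar>z - y\<bar> / m"
        by (auto simp: eventually_at_filter)
    qed
    then show ?thesis
      unfolding has_field_derivative_iff using Lim_null by blast
  qed
  then have dp: "deriv (fenchel_conjugate g) = p" by (auto intro: DERIV_imp_deriv)
  show "(fenchel_conjugate g has_real_derivative deriv (fenchel_conjugate g) y) (at y)"
    by (simp add: der dp)
  show "fenchel_conjugate g y + deriv (fenchel_conjugate g) y * (z - y) \<le> fenchel_conjugate g z"
    by (simp add: conv dp)
  have "p y < p z" if "y < z" for y z
  proof -
    have "p y \<noteq> p z" using p(1)[of y] p(1)[of z] that by auto
    then have "0 < (z - y) * (p z - p y)"
      using strong[of z y] m(2) by (smt (verit) mult_pos_pos zero_less_power2)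
    then show ?thesis using that by (simp add: zero_less_mult_iff)
  qed
  then show "strict_mono (deriv (fenchel_conjugate g))" by (simp add: dp strict_mono_def)
qed

section \<open>The dual objective\<close>

context
  fixes f :: "'v::finite \<Rightarrow> real \<Rightarrow> real" and Ms \<mu> :: "'v \<Rightarrow> real" and A :: "real^'e::finite^'v"
  assumes f: "\<And>i. smooth_strongly_convex (Ms i) (\<mu> i) (f i)"
begin

lemma dual_objective_line_derivative:
  "((\<lambda>t. dual_objective f A (x + t *\<^sub>R axis l 1)) has_real_derivative
     (\<Sum>i\<in>UNIV. A $ i $ l * deriv (fenchel_conjugate (f i)) ((A *v (x + t *\<^sub>R axis l 1)) $ i))) (at t)"
proof -
  have lin: "(A *v (x + s *\<^sub>R axis l 1)) $ i = (A *v x) $ i + s * A $ i $ l" for s i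
    by (simp add: matrix_vector_right_distrib matrix_vector_mult_scaleR
        matrix_vector_mult_basis column_def)
  show ?thesis
    unfolding dual_objective_def lin
    by (rule derivative_eq_intros DERIV_chain2[OF fenchel_conjugate_derivative(1)[OF f]] refl | simp)+
       (simp add: mult.commute)
qed

lemma partial_deriv_dual_objective:
  "partial_deriv l (dual_objective f A) x =
     (\<Sum>i\<in>UNIV. A $ i $ l * deriv (fenchel_conjugate (f i)) ((A *v x) $ i))"
  unfolding partial_deriv_def
  using DERIV_imp_deriv[OF dual_objective_line_derivative[of x l 0]] by simp

text \<open>
  The supporting lines of the conjugates add up: moving the matrix to the other side of the inner
  product turns the sum of their slopes into the gradient.
\<close>

lemma dual_objective_convex:
  "dual_objective f A x + grad (dual_objective f A) x \<bullet> (y - x) \<le> dual_objective f A y"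
proof -
  let ?d = "\<lambda>i. deriv (fenchel_conjugate (f i)) ((A *v x) $ i)"
  have "grad (dual_objective f A) x \<bullet> (y - x) = (\<Sum>l\<in>UNIV. \<Sum>i\<in>UNIV. ?d i * (A $ i $ l * (y - x) $ l))"
    by (simp add: grad_def inner_vec_def partial_deriv_dual_objective sum_distrib_right
        sum_distrib_left mult_ac)
  also have "\<dots> = (\<Sum>i\<in>UNIV. ?d i * (A *v (y - x)) $ i)"
    by (subst sum.swap) (simp add: matrix_vector_mult_def sum_distrib_left)
  also have "\<dots> = (\<Sum>i\<in>UNIV. ?d i * ((A *v y) $ i - (A *v x) $ i))"
    by (simp add: matrix_vector_mult_diff_distrib)
  finally show ?thesis
    unfolding dual_objective_def
    by (simp add: sum_mono fenchel_conjugate_derivative(2)[OF f] flip: sum.distrib)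
qed

text \<open>
  A unit step along edge \<open>l\<close> moves the argument of each conjugate at an end of \<open>l\<close>, in the direction
  of the matrix entry by which its derivative is multiplied. These derivatives increase strictly, so
  the partial derivative changes and \<open>Lc l\<close> cannot vanish. Positivity is what makes the step size
  \<open>1 / Lc l\<close> and the weighted norm meaningful.
\<close>

lemma coordinate_constant_pos:
  assumes A: "is_incidence_matrix ends A" and L: "coordinatewise_smooth Lc (dual_objective f A)"
  shows "0 < Lc l"
proof -
  let ?\<phi> = "\<lambda>i. deriv (fenchel_conjugate (f i))"
  obtain j where j: "A $ j $ l = 1" using A by (auto simp: is_incidence_matrix_def) metis
  have "0 < (\<Sum>i\<in>UNIV. A $ i $ l * (?\<phi> i ((A *v 0) $ i + A $ i $ l) - ?\<phi> i ((A *v 0) $ i)))"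
  proof (rule sum_pos2[of _ j])
    have mono: "strict_mono (?\<phi> i)" for i by (rule fenchel_conjugate_derivative(3)[OF f])
    show "0 < A $ j $ l * (?\<phi> j ((A *v 0) $ j + A $ j $ l) - ?\<phi> j ((A *v 0) $ j))"
      using mono[of j] by (simp add: j strict_mono_less)
    show "0 \<le> A $ i $ l * (?\<phi> i ((A *v 0) $ i + A $ i $ l) - ?\<phi> i ((A *v 0) $ i))" for i
      using strict_mono_mono[OF mono[of i]]
      by (cases "0 \<le> A $ i $ l") (auto simp: zero_le_mult_iff mono_def)
  qed auto
  also have "\<dots> = partial_deriv l (dual_objective f A) (0 + 1 *\<^sub>R axis l 1)
      - partial_deriv l (dual_objective f A) 0"
    by (simp add: partial_deriv_dual_objective matrix_vector_mult_basis column_def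
        right_diff_distrib sum_subtractf)
  also have "\<dots> \<le> Lc l"
    using L[unfolded coordinatewise_smooth_def, rule_format, of l 0 1] by simp
  finally show ?thesis .
qed

end

text \<open>
  On the line through \<open>x\<close> in direction \<open>l\<close>, \<open>F\<close> lies below the parabola of curvature \<open>Lc l\<close> that is
  tangent to it at \<open>x\<close>. The step taken goes to the vertex of this parabola.
\<close>

lemma coordinate_descent_step:
  fixes F :: "real^'e::finite \<Rightarrow> real"
  assumes smooth: "coordinatewise_smooth Lc F" and L: "0 < Lc l"
    and diff: "\<And>t. ((\<lambda>s. F (x + s *\<^sub>R axis l 1)) has_real_derivative
        partial_deriv l F (x + t *\<^sub>R axis l 1)) (at t)"
  shows "F (x - (1 / Lc l * partial_deriv l F x) *\<^sub>R axis l 1)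
    \<le> F x - 1 / Lc l * (partial_deriv l F x)\<^sup>2 / 2"
proof -
  let ?D = "partial_deriv l F"
  \<comment> \<open>\<open>F\<close> minus the parabola, up to a constant; it has its maximum at \<open>0\<close>.\<close>
  define \<psi> where "\<psi> = (\<lambda>t. F (x + t *\<^sub>R axis l 1) - ?D x * t - Lc l / 2 * t\<^sup>2)"
  have der: "(\<psi> has_real_derivative ?D (x + t *\<^sub>R axis l 1) - ?D x - Lc l * t) (at t)" for t
    unfolding \<psi>_def by (auto intro!: derivative_eq_intros diff)
  have bound: "\<bar>?D (x + t *\<^sub>R axis l 1) - ?D x\<bar> \<le> Lc l * \<bar>t\<bar>" for t
    using smooth by (simp add: coordinatewise_smooth_def)
  have "\<psi> t \<le> \<psi> 0" for t
  proof (cases "0 \<le> t")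
    case True
    show ?thesis
      by (rule DERIV_nonpos_imp_nonincreasing[OF True])
         (metis der bound abs_le_iff abs_of_nonneg diff_le_0_iff_le)
  next
    case False
    then have "t \<le> 0" by simp
    show ?thesis
    proof (rule DERIV_nonneg_imp_nondecreasing[OF \<open>t \<le> 0\<close>])
      fix s :: real assume "s \<le> 0"
      then have "0 \<le> ?D (x + s *\<^sub>R axis l 1) - ?D x - Lc l * s"
        using bound[of s] by (simp add: abs_le_iff)
      then show "\<exists>y. (\<psi> has_real_derivative y) (at s) \<and> 0 \<le> y" using der by blast
    qed
  qed
  from this[of "- (1 / Lc l * ?D x)"] show ?thesis
    using L by (simp add: \<psi>_def field_simps power2_eq_square)
qed

section \<open>Dual norms and strong convexity constants\<close>

text \<open>
  Homogeneity and domination of the Euclidean norm are the properties of a norm that make the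
  supremum in its dual norm finite, positive away from \<open>0\<close>, and compatible with a Cauchy-Schwarz
  inequality.
\<close>

locale coordinate_gauge =
  fixes N :: "real^'e::finite \<Rightarrow> real" and C :: real
  assumes homogeneous: "N (c *\<^sub>R x) = \<bar>c\<bar> * N x"
    and norm_le: "norm x \<le> C * N x"
    and C_pos: "0 < C"
begin

lemma pos: "x \<noteq> 0 \<Longrightarrow> 0 < N x"
  using norm_le[of x] C_pos by (smt (verit) zero_less_norm_iff zero_less_mult_iff)

lemma zero: "N 0 = 0"
  using homogeneous[of 0 0] by simp

lemma bdd_above_dual: "bdd_above {z \<bullet> x | x. N x \<le> 1}"
proof (rule bdd_aboveI)
  fix r assume "r \<in> {z \<bullet> x | x. N x \<le> 1}"
  then obtain x where x: "r = z \<bullet> x" "N x \<le> 1" by auto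
  have "norm x \<le> C * 1"
    using norm_le[of x] mult_left_mono[OF x(2), of C] C_pos by linarith
  then show "r \<le> norm z * (C * 1)"
    using norm_cauchy_schwarz[of z x] mult_left_mono[of "norm x" "C * 1" "norm z"] x(1) by simp
qed

lemma inner_le_dual_norm: "N x \<le> 1 \<Longrightarrow> z \<bullet> x \<le> dual_norm N z"
  unfolding dual_norm_def by (rule cSup_upper[OF _ bdd_above_dual]) auto

lemma inner_le_mult_dual_norm: "z \<bullet> x \<le> N x * dual_norm N z"
proof (cases "x = 0")
  case False
  with pos have "0 < N x" by simp
  then show ?thesis
    using inner_le_dual_norm[of "(1 / N x) *\<^sub>R x" z] by (simp add: homogeneous field_simps)
qed (simp add: zero)

lemma dual_norm_pos:
  assumes "z \<noteq> 0" shows "0 < dual_norm N z"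
proof -
  have "0 < N z * dual_norm N z"
    using inner_le_mult_dual_norm[of z z] assms inner_gt_zero_iff[of z] by linarith
  then show ?thesis using pos[OF assms] by (simp add: zero_less_mult_iff)
qed

lemma dual_norm_nonneg: "0 \<le> dual_norm N z"
  using inner_le_dual_norm[of 0 z] zero by simp

lemma dual_norm_le_if_gauge_le:
  assumes "\<And>x. N x \<le> c * N' x" "0 < c" "N' 0 \<le> 1"
  shows "dual_norm N' z \<le> c * dual_norm N z"
  unfolding dual_norm_def[of N']
proof (rule cSup_least)
  show "{z \<bullet> x | x. N' x \<le> 1} \<noteq> {}" using assms(3) by auto
  fix r assume "r \<in> {z \<bullet> x | x. N' x \<le> 1}"
  then obtain x where x: "r = z \<bullet> x" "N' x \<le> 1" by auto
  have "N x \<le> c"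
    using assms(1)[of x] mult_left_mono[OF x(2), of c] assms(2) by linarith
  then have "N ((1 / c) *\<^sub>R x) \<le> 1" using assms(2) by (simp add: homogeneous)
  from inner_le_dual_norm[OF this, of z] show "r \<le> c * dual_norm N z"
    using assms(2) x(1) by (simp add: field_simps)
qed

text \<open>
  Along one fixed nonzero direction the quadratic term has a positive coefficient, which caps every
  admissible constant. So the supremum in the definition of the strong convexity constant is a
  genuine one.
\<close>

lemma admissible_bdd_above:
  "bdd_above {\<sigma>. \<forall>x y. F x + grad F x \<bullet> (y - x) + \<sigma> / 2 * (dual_norm N (y - x))\<^sup>2 \<le> F y}"
proof (rule bdd_aboveI)
  define z :: "real^'e" where "z = axis undefined 1"
  have D: "0 < dual_norm N z" by (rule dual_norm_pos) (simp add: z_def)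
  fix \<sigma>
  assume "\<sigma> \<in> {\<sigma>. \<forall>x y. F x + grad F x \<bullet> (y - x) + \<sigma> / 2 * (dual_norm N (y - x))\<^sup>2 \<le> F y}"
  then have "F 0 + grad F 0 \<bullet> (z - 0) + \<sigma> / 2 * (dual_norm N (z - 0))\<^sup>2 \<le> F z" by blast
  then show "\<sigma> \<le> 2 * (F z - F 0 - grad F 0 \<bullet> z) / (dual_norm N z)\<^sup>2"
    using D by (simp add: field_simps)
qed

text \<open>
  A Polyak-Lojasiewicz inequality. The strong convexity lower bound at \<open>x\<close>, evaluated at the minimizer
  \<open>x0\<close>, is at least \<open>F x - g * D + \<sigma> / 2 * D\<^sup>2\<close>, where \<open>g\<close> is the norm of the gradient and \<open>D\<close> the dual
  norm of \<open>x0 - x\<close>. Minimizing over \<open>D\<close> leaves \<open>F x - g\<^sup>2 / (2 * \<sigma>)\<close>.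
\<close>

lemma gradient_dominance:
  assumes conv: "\<And>x y. F x + grad F x \<bullet> (y - x) \<le> F y" and min: "\<And>x. F x0 \<le> F x"
  shows "2 * strong_convexity_const F (dual_norm N) * (F x - F x0) \<le> (N (grad F x))\<^sup>2"
proof -
  let ?Q = "{\<sigma>. \<forall>x y. F y \<ge> F x + grad F x \<bullet> (y - x) + \<sigma> / 2 * (dual_norm N (y - x))\<^sup>2}"
  have admissible: "2 * \<sigma> * (F x - F x0) \<le> (N (grad F x))\<^sup>2" if \<sigma>: "\<sigma> \<in> ?Q" for \<sigma>
  proof (cases "0 < \<sigma>")
    case True
    let ?D = "dual_norm N (x0 - x)" and ?g = "N (grad F x)"
    have "F x + grad F x \<bullet> (x0 - x) + \<sigma> / 2 * ?D\<^sup>2 \<le> F x0"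
      using \<sigma> by blast
    moreover have "(x0 - x) \<bullet> - grad F x \<le> ?g * ?D"
      using inner_le_mult_dual_norm[of "x0 - x" "- grad F x"] homogeneous[of "- 1" "grad F x"]
      by simp
    ultimately have "F x - F x0 \<le> ?g * ?D - \<sigma> / 2 * ?D\<^sup>2"
      by (simp add: inner_commute)
    then have "2 * \<sigma> * (F x - F x0) \<le> 2 * \<sigma> * (?g * ?D - \<sigma> / 2 * ?D\<^sup>2)"
      using True by simp
    also have "\<dots> = ?g\<^sup>2 - (?g - \<sigma> * ?D)\<^sup>2" by (simp add: power2_eq_square algebra_simps)
    also have "\<dots> \<le> ?g\<^sup>2" by simp
    finally show ?thesis .
  next
    case False
    then have "2 * \<sigma> * (F x - F x0) \<le> 0" using min[of x] by (simp add: mult_le_0_iff)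
    then show ?thesis by (smt (verit) zero_le_power2)
  qed
  \<comment> \<open>Convexity keeps the set of admissible constants nonempty; \<open>Sup {}\<close> would be unspecified.\<close>
  have "0 \<in> ?Q" using conv by simp
  then have "Sup ?Q * (2 * (F x - F x0)) \<le> (N (grad F x))\<^sup>2"
  proof (cases "F x = F x0")
    case False
    with min[of x] have gap: "0 < 2 * (F x - F x0)" by simp
    have "Sup ?Q \<le> (N (grad F x))\<^sup>2 / (2 * (F x - F x0))"
    proof (rule cSup_least)
      show "?Q \<noteq> {}" using \<open>0 \<in> ?Q\<close> by blast
      show "\<sigma> \<le> (N (grad F x))\<^sup>2 / (2 * (F x - F x0))" if "\<sigma> \<in> ?Q" for \<sigma>
        using admissible[OF that] gap by (simp add: pos_le_divide_eq mult.commute mult.left_commute)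
    qed
    then show ?thesis using gap by (simp only: pos_le_divide_eq)
  qed simp
  then show ?thesis unfolding strong_convexity_const_def by (simp only: mult_ac)
qed

end

text \<open>
  Dualizing reverses \<open>N \<le> sqrt c * N'\<close> to \<open>dual_norm N' \<le> sqrt c * dual_norm N\<close>, so dividing an
  admissible constant for \<open>N\<close> by \<open>c\<close> gives one for \<open>N'\<close>. This needs the constant to be nonnegative;
  negative ones lie below \<open>0\<close>, which convexity makes admissible.
\<close>

lemma strong_convexity_const_le_if_gauge_le:
  assumes N: "coordinate_gauge N C" and N': "coordinate_gauge N' C'"
    and le: "\<And>x. N x \<le> sqrt c * N' x" and c: "0 < c"
    and conv: "\<And>x y. F x + grad F x \<bullet> (y - x) \<le> F y"
  shows "strong_convexity_const F (dual_norm N) / c \<le> strong_convexity_const F (dual_norm N')"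
proof -
  interpret N: coordinate_gauge N C by (rule N)
  interpret N': coordinate_gauge N' C' by (rule N')
  let ?Q = "\<lambda>N. {\<sigma>. \<forall>x y. F y \<ge> F x + grad F x \<bullet> (y - x) + \<sigma> / 2 * (dual_norm N (y - x))\<^sup>2}"
  have zero: "0 \<in> ?Q N" "0 \<in> ?Q N'" using conv by auto
  have "Sup (?Q N) \<le> c * Sup (?Q N')"
  proof (rule cSup_least)
    show "?Q N \<noteq> {}" using zero(1) by blast
    fix \<sigma> assume \<sigma>: "\<sigma> \<in> ?Q N"
    have "max 0 \<sigma> / c \<in> ?Q N'"
    proof (cases "0 \<le> \<sigma>")
      case True
      have "F x + grad F x \<bullet> (y - x) + \<sigma> / c / 2 * (dual_norm N' (y - x))\<^sup>2 \<le> F y" for x y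
      proof -
        have "dual_norm N' (y - x) \<le> sqrt c * dual_norm N (y - x)"
          by (rule N.dual_norm_le_if_gauge_le) (use le c N'.zero in auto)
        then have "(dual_norm N' (y - x))\<^sup>2 \<le> (sqrt c * dual_norm N (y - x))\<^sup>2"
          using N'.dual_norm_nonneg by (rule power_mono)
        also have "\<dots> = c * (dual_norm N (y - x))\<^sup>2" using c by (simp add: power_mult_distrib)
        finally have "\<sigma> / c / 2 * (dual_norm N' (y - x))\<^sup>2
            \<le> \<sigma> / c / 2 * (c * (dual_norm N (y - x))\<^sup>2)"
          using True c by (intro mult_left_mono) auto
        also have "\<dots> = \<sigma> / 2 * (dual_norm N (y - x))\<^sup>2" using c by simp
        finally have "\<sigma> / c / 2 * (dual_norm N' (y - x))\<^sup>2 \<le> \<sigma> / 2 * (dual_norm N (y - x))\<^sup>2" .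
        moreover have "F x + grad F x \<bullet> (y - x) + \<sigma> / 2 * (dual_norm N (y - x))\<^sup>2 \<le> F y"
          using \<sigma> by blast
        ultimately show ?thesis by linarith
      qed
      then show ?thesis using True by (simp add: max_def)
    qed (use zero(2) in simp)
    then have "max 0 \<sigma> / c \<le> Sup (?Q N')"
      by (rule cSup_upper) (rule N'.admissible_bdd_above)
    then have "max 0 \<sigma> \<le> c * Sup (?Q N')" using c by (simp add: field_simps)
    then show "\<sigma> \<le> c * Sup (?Q N')" by simp
  qed
  then show ?thesis using c by (simp add: strong_convexity_const_def field_simps)
qed

section \<open>Setwise maximum norms\<close>

definition nodewise_max :: "('v \<Rightarrow> 'e set) \<Rightarrow> ('e \<Rightarrow> real) \<Rightarrow> real^'e::finite \<Rightarrow> 'v::finite \<Rightarrow> real" where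
  "nodewise_max S Lc x i = (if S i = {} then 0 else MAX l\<in>S i. 1 / Lc l * (x $ l)\<^sup>2)"

lemma nodewise_max_upper: "l \<in> S i \<Longrightarrow> 1 / Lc l * (x $ l)\<^sup>2 \<le> nodewise_max S Lc x i"
  by (auto simp: nodewise_max_def intro!: Max_ge)

lemma nodewise_max_attained:
  assumes "S i \<noteq> {}"
  obtains l where "l \<in> S i" "nodewise_max S Lc x i = 1 / Lc l * (x $ l)\<^sup>2"
proof -
  have "nodewise_max S Lc x i \<in> (\<lambda>l. 1 / Lc l * (x $ l)\<^sup>2) ` S i"
    using assms by (auto simp: nodewise_max_def intro!: Max_in)
  then show ?thesis using that by auto
qed

lemma nodewise_max_nonneg: "(\<And>l. 0 < Lc l) \<Longrightarrow> 0 \<le> nodewise_max S Lc x i"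
  by (cases "S i = {}") (simp add: nodewise_max_def, metis nodewise_max_attained less_imp_le
      mult_nonneg_nonneg zero_le_divide_1_iff zero_le_power2)

lemma norm_SML_eq_sqrt: "norm_SML S Lc x = sqrt (\<Sum>i\<in>UNIV. nodewise_max S Lc x i)"
  by (simp only: norm_SML_def nodewise_max_def)

lemma norm_SML_power2:
  assumes "\<And>l. 0 < Lc l"
  shows "(norm_SML S Lc x)\<^sup>2 = (\<Sum>i\<in>UNIV. nodewise_max S Lc x i)"
  by (simp add: norm_SML_eq_sqrt nodewise_max_nonneg[OF assms] sum_nonneg)

lemma nodewise_max_scaleR:
  "nodewise_max S Lc (c *\<^sub>R x) i = c\<^sup>2 * nodewise_max S Lc x i"
proof (cases "S i = {}")
  case False
  have "(MAX l\<in>S i. c\<^sup>2 * (1 / Lc l * (x $ l)\<^sup>2)) = c\<^sup>2 * (MAX l\<in>S i. 1 / Lc l * (x $ l)\<^sup>2)"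
    using mono_Max_commute[of "(*) (c\<^sup>2)" "(\<lambda>l. 1 / Lc l * (x $ l)\<^sup>2) ` S i"] False
    by (simp add: mono_def mult_left_mono image_image)
  with False show ?thesis by (simp add: nodewise_max_def power_mult_distrib mult_ac)
qed (simp add: nodewise_max_def)

text \<open>
  Every coordinate is seen by some node, so the norm controls it up to the factor \<open>sqrt (Lc l)\<close>; the
  sum of these factors then controls the 1-norm.
\<close>

lemma coordinate_gauge_norm_SML:
  assumes L: "\<And>l. 0 < Lc l" and cover: "\<And>l. \<exists>i. l \<in> S i"
  shows "coordinate_gauge (norm_SML S Lc) (\<Sum>l\<in>UNIV. sqrt (Lc l))"
proof
  show "norm_SML S Lc (c *\<^sub>R x) = \<bar>c\<bar> * norm_SML S Lc x" for c x
    by (simp add: norm_SML_eq_sqrt nodewise_max_scaleR real_sqrt_mult flip: sum_distrib_left)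
  show "0 < (\<Sum>l\<in>UNIV. sqrt (Lc l))"
    by (rule sum_pos) (auto simp: L)
  show "norm x \<le> (\<Sum>l\<in>UNIV. sqrt (Lc l)) * norm_SML S Lc x" for x
  proof -
    have nonneg: "0 \<le> norm_SML S Lc x"
      by (simp add: norm_SML_eq_sqrt nodewise_max_nonneg[OF L] sum_nonneg)
    have "\<bar>x $ l\<bar> \<le> sqrt (Lc l) * norm_SML S Lc x" for l
    proof -
      obtain i where "l \<in> S i" using cover by blast
      then have "1 / Lc l * (x $ l)\<^sup>2 \<le> nodewise_max S Lc x i" by (rule nodewise_max_upper)
      also have "\<dots> \<le> (norm_SML S Lc x)\<^sup>2"
        unfolding norm_SML_power2[OF L] by (rule member_le_sum) (auto simp: nodewise_max_nonneg[OF L])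
      finally have "(x $ l)\<^sup>2 \<le> (sqrt (Lc l) * norm_SML S Lc x)\<^sup>2"
        using L[of l] by (simp add: power_mult_distrib field_simps)
      then show ?thesis
        using nonneg L[of l] abs_le_square_iff[of "x $ l" "sqrt (Lc l) * norm_SML S Lc x"]
        by (simp add: abs_of_nonneg)
    qed
    then have "(\<Sum>l\<in>UNIV. \<bar>x $ l\<bar>) \<le> (\<Sum>l\<in>UNIV. sqrt (Lc l)) * norm_SML S Lc x"
      unfolding sum_distrib_right by (rule sum_mono)
    then show ?thesis using norm_le_l1_cart[of x] by linarith
  qed
qed

lemma norm_SM_eq_norm_SML: "norm_SM S = norm_SML S (\<lambda>_. 1)"
  by (intro ext) (simp add: norm_SM_def norm_SML_def cong: if_cong)

lemma norm_SM_le_norm_SML: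
  assumes L: "\<And>l. 0 < Lc l" "\<And>l. Lc l \<le> L" and "0 < L"
  shows "norm_SM S x \<le> sqrt L * norm_SML S Lc x"
proof -
  have "nodewise_max S (\<lambda>_. 1) x i \<le> L * nodewise_max S Lc x i" for i
  proof (cases "S i = {}")
    case False
    then obtain l where l: "l \<in> S i" "nodewise_max S (\<lambda>_. 1) x i = 1 / 1 * (x $ l)\<^sup>2"
      by (rule nodewise_max_attained)
    have "(x $ l)\<^sup>2 \<le> L * (1 / Lc l * (x $ l)\<^sup>2)"
      using L[of l] by (simp add: pos_le_divide_eq mult.commute[of L] mult.commute[of _ "(x $ l)\<^sup>2"] mult_left_mono)
    also have "\<dots> \<le> L * nodewise_max S Lc x i"
      by (intro mult_left_mono nodewise_max_upper l(1) less_imp_le[OF \<open>0 < L\<close>])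
    finally show ?thesis using l(2) by simp
  qed (simp add: nodewise_max_def)
  then have "(\<Sum>i\<in>UNIV. nodewise_max S (\<lambda>_. 1) x i) \<le> L * (\<Sum>i\<in>UNIV. nodewise_max S Lc x i)"
    unfolding sum_distrib_left by (rule sum_mono)
  then show ?thesis
    unfolding norm_SM_eq_norm_SML
    by (simp add: norm_SML_eq_sqrt flip: real_sqrt_mult)
qed

section \<open>Conditional expectation over the drawn node\<close>

text \<open>
  Since finite sets are closed, the \<open>\<sigma>\<close>-algebra generated by a finitely valued \<open>X\<close> contains every event
  on which the value of \<open>X\<close> is prescribed. The objective and its partial derivatives thus become
  measurable functions of an iterate without an argument about their regularity.
\<close>

lemma measurable_vimage_algebra_comp_finite_range:
  fixes X :: "'a \<Rightarrow> 'b::t1_space"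
  assumes fin: "finite (X ` \<Omega>)" and \<phi>: "\<And>x. \<phi> x \<in> space N"
  shows "(\<lambda>\<omega>. \<phi> (X \<omega>)) \<in> vimage_algebra \<Omega> X borel \<rightarrow>\<^sub>M N"
proof (rule measurableI)
  fix B
  have "closed (X ` \<Omega> \<inter> \<phi> -` B)" using fin by (intro finite_imp_closed) auto
  then have "X -` (X ` \<Omega> \<inter> \<phi> -` B) \<inter> \<Omega> \<in> sets (vimage_algebra \<Omega> X borel)"
    by (intro in_vimage_algebra borel_closed)
  also have "X -` (X ` \<Omega> \<inter> \<phi> -` B) \<inter> \<Omega>
      = (\<lambda>\<omega>. \<phi> (X \<omega>)) -` B \<inter> space (vimage_algebra \<Omega> X borel)" by auto
  finally show "(\<lambda>\<omega>. \<phi> (X \<omega>)) -` B \<inter> space (vimage_algebra \<Omega> X borel)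
      \<in> sets (vimage_algebra \<Omega> X borel)" .
qed (simp add: \<phi>)

lemma sets_vimage_algebra_subset_if_factors:
  assumes "\<And>\<omega>. \<omega> \<in> \<Omega> \<Longrightarrow> X \<omega> = g (H \<omega>)"
  shows "sets (vimage_algebra \<Omega> X M) \<subseteq> sets (vimage_algebra \<Omega> H (count_space UNIV))"
  unfolding sets_vimage_algebra[of \<Omega> X]
proof (rule sets.sigma_sets_subset[of _ "vimage_algebra \<Omega> H (count_space UNIV)", simplified], safe)
  fix B assume "B \<in> sets M"
  have "X -` B \<inter> \<Omega> = H -` (g -` B) \<inter> \<Omega>" using assms by auto
  then show "X -` B \<inter> \<Omega> \<in> sets (vimage_algebra \<Omega> H (count_space UNIV))"
    by (simp add: in_vimage_algebra)
qed

text \<open>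
  Averaging over an independent uniform index: the integrand splits into one term for each index
  value, the factor \<open>\<Phi> i\<close> comes out of the conditional expectation because it is known given \<open>G\<close>, and
  the indicator of \<open>node = i\<close> has constant conditional expectation by independence.
\<close>

lemma (in prob_space) real_cond_exp_uniform_choice:
  fixes node :: "'a \<Rightarrow> 'v::finite"
  assumes G: "subalgebra M G"
    and node: "node \<in> M \<rightarrow>\<^sub>M count_space UNIV"
    and unif: "distr M (count_space UNIV) node = uniform_count_measure UNIV"
    and indep: "indep_set (sets G) (sets (vimage_algebra (space M) node (count_space UNIV)))"
    and \<Phi>: "\<And>i. \<Phi> i \<in> borel_measurable G" "\<And>i. integrable M (\<Phi> i)"
  shows "AE \<omega> in M. real_cond_exp M G (\<lambda>\<omega>. \<Phi> (node \<omega>) \<omega>) \<omega> = (\<Sum>i\<in>UNIV. \<Phi> i \<omega>) / CARD('v)"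
    and "integrable M (\<lambda>\<omega>. \<Phi> (node \<omega>) \<omega>)"
proof -
  interpret G: finite_measure_subalgebra M G
    by standard (rule G)
  let ?E = "\<lambda>i. node -` {i} \<inter> space M"
  have E[measurable]: "?E i \<in> events" for i using node by (rule measurable_sets) simp
  have pr: "prob (?E i) = 1 / CARD('v)" for i
  proof -
    have "prob (?E i) = measure (distr M (count_space UNIV) node) {i}"
      using node by (simp add: measure_distr)
    then show ?thesis by (simp add: unif measure_uniform_count_measure)
  qed
  have E_indep: "prob (A \<inter> ?E i) = prob A * prob (?E i)" if "A \<in> sets G" for A i
    by (rule indep_setD[OF indep that]) (rule in_vimage_algebra, simp)
  have ind: "AE \<omega> in M. real_cond_exp M G (indicat_real (?E i)) \<omega> = 1 / CARD('v)" for i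
  proof (rule G.real_cond_exp_charact)
    fix A assume A: "A \<in> sets G"
    then have A': "A \<in> events" using G by (auto simp: subalgebra_def)
    have "(\<integral>\<omega>\<in>A. indicat_real (?E i) \<omega> \<partial>M) = prob (A \<inter> ?E i)"
      using A' by (simp add: set_lebesgue_integral_def flip: indicator_inter_arith)
    also have "\<dots> = (\<integral>\<omega>\<in>A. 1 / CARD('v) \<partial>M)"
      using A' by (simp add: E_indep[OF A] pr set_integral_const emeasure_eq_measure)
    finally show "(\<integral>\<omega>\<in>A. indicat_real (?E i) \<omega> \<partial>M) = (\<integral>\<omega>\<in>A. 1 / CARD('v) \<partial>M)" .
  qed (auto simp: integrable_real_indicator emeasure_eq_measure)
  have int: "integrable M (\<lambda>\<omega>. \<Phi> i \<omega> * indicat_real (?E i) \<omega>)" for i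
    using integrable_mult_indicator[OF E[of i] \<Phi>(2)[of i]] by (simp add: mult.commute)
  have split: "\<Phi> (node \<omega>) \<omega> = (\<Sum>i\<in>UNIV. \<Phi> i \<omega> * indicat_real (?E i) \<omega>)" if "\<omega> \<in> space M" for \<omega>
    using that by (simp add: indicator_def if_distrib sum.delta' cong: if_cong)
  have int_split: "integrable M (\<lambda>\<omega>. \<Sum>i\<in>UNIV. \<Phi> i \<omega> * indicat_real (?E i) \<omega>)"
    by (intro Bochner_Integration.integrable_sum int)
  then show int_sum: "integrable M (\<lambda>\<omega>. \<Phi> (node \<omega>) \<omega>)"
    by (subst Bochner_Integration.integrable_cong[OF refl split])
  have "AE \<omega> in M. real_cond_exp M G (\<lambda>\<omega>. \<Phi> (node \<omega>) \<omega>) \<omega>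
      = real_cond_exp M G (\<lambda>\<omega>. \<Sum>i\<in>UNIV. \<Phi> i \<omega> * indicat_real (?E i) \<omega>) \<omega>"
    by (rule G.real_cond_exp_cong)
       (auto simp only: split intro!: AE_I2 borel_measurable_integrable int_sum int_split)
  moreover have "AE \<omega> in M. real_cond_exp M G (\<lambda>\<omega>. \<Sum>i\<in>UNIV. \<Phi> i \<omega> * indicat_real (?E i) \<omega>) \<omega>
      = (\<Sum>i\<in>UNIV. real_cond_exp M G (\<lambda>\<omega>. \<Phi> i \<omega> * indicat_real (?E i) \<omega>) \<omega>)"
    by (rule G.real_cond_exp_sum) (rule int)
  moreover have "AE \<omega> in M. \<forall>i. real_cond_exp M G (\<lambda>\<omega>. \<Phi> i \<omega> * indicat_real (?E i) \<omega>) \<omega>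
      = \<Phi> i \<omega> * real_cond_exp M G (indicat_real (?E i)) \<omega>"
    unfolding AE_all_countable by (auto intro!: G.real_cond_exp_mult \<Phi> int)
  moreover have "AE \<omega> in M. \<forall>i. real_cond_exp M G (indicat_real (?E i)) \<omega> = 1 / CARD('v)"
    unfolding AE_all_countable using ind by blast
  ultimately show "AE \<omega> in M. real_cond_exp M G (\<lambda>\<omega>. \<Phi> (node \<omega>) \<omega>) \<omega> = (\<Sum>i\<in>UNIV. \<Phi> i \<omega>) / CARD('v)"
    by eventually_elim (simp add: sum_divide_distrib)
qed

context
  fixes P :: "'a measure" and S :: "'v::finite \<Rightarrow> 'e::finite set" and Lc :: "'e \<Rightarrow> real"
    and F :: "real^'e \<Rightarrow> real" and lam0 :: "real^'e"
    and node :: "nat \<Rightarrow> 'a \<Rightarrow> 'v" and edge :: "nat \<Rightarrow> 'a \<Rightarrow> 'e" and lam :: "nat \<Rightarrow> 'a \<Rightarrow> real^'e"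
  assumes alg: "sgsl_cd P S Lc F lam0 node edge lam"
begin

abbreviation history :: "nat \<Rightarrow> 'a \<Rightarrow> ('v \<times> 'e) list" where
  "history k \<omega> \<equiv> map (\<lambda>j. (node j \<omega>, edge j \<omega>)) [0..<k]"

text \<open>
  Each iterate is a deterministic function of the finite list of draws and choices so far. This
  gives it finite range and carries the independence of the next draw over from the list to the
  iterate.
\<close>

lemma sgsl_cd_iterate_factors:
  obtains g where "\<And>\<omega>. \<omega> \<in> space P \<Longrightarrow> lam k \<omega> = g (history k \<omega>)"
proof (induction k arbitrary: thesis)
  case 0
  have "\<forall>\<omega>\<in>space P. lam 0 \<omega> = lam0" using alg unfolding sgsl_cd_def by blast
  then show ?case by (intro 0[of "\<lambda>_. lam0"]) simp
next
  case (Suc k)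
  obtain g where g: "\<And>\<omega>. \<omega> \<in> space P \<Longrightarrow> lam k \<omega> = g (history k \<omega>)" using Suc.IH by blast
  let ?step = "\<lambda>x (i, l). if S i = {} then x
     else x - (1 / Lc l * partial_deriv l F x) *\<^sub>R axis l 1"
  have "lam (Suc k) \<omega> = ?step (lam k \<omega>) (node k \<omega>, edge k \<omega>)" if "\<omega> \<in> space P" for \<omega>
    using alg that unfolding sgsl_cd_def by auto
  then show ?case
    by (intro Suc.prems[of "\<lambda>h. ?step (g (butlast h)) (last h)"]) (simp add: g)
qed

lemma sgsl_cd_finite_range: "finite (lam k ` space P)"
proof -
  obtain g where g: "\<And>\<omega>. \<omega> \<in> space P \<Longrightarrow> lam k \<omega> = g (history k \<omega>)"
    using sgsl_cd_iterate_factors[of k] by blast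
  have "lam k ` space P \<subseteq> g ` {h. set h \<subseteq> UNIV \<and> length h = k}"
    by (auto simp: g intro!: imageI)
  then show ?thesis by (rule finite_subset) (intro finite_imageI finite_lists_length_eq, simp)
qed

lemma sgsl_cd_subset_history:
  "sets (vimage_algebra (space P) (lam k) borel)
     \<subseteq> sets (vimage_algebra (space P) (history k) (count_space UNIV))"
  by (rule sgsl_cd_iterate_factors[of k]) (rule sets_vimage_algebra_subset_if_factors)

text \<open>
  The past includes the edges chosen, so it may be richer than the iterate, e.g. when ties are broken
  at random. Independence passes to the smaller \<open>\<sigma>\<close>-algebra.
\<close>

lemma sgsl_cd_node_indep:
  "prob_space.indep_set P (sets (vimage_algebra (space P) (lam k) borel))
     (sets (vimage_algebra (space P) (node k) (count_space UNIV)))"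
proof -
  interpret prob_space P using alg unfolding sgsl_cd_def by blast
  have "indep_set (sets (vimage_algebra (space P) (history k) (count_space UNIV)))
     (sets (vimage_algebra (space P) (node k) (count_space UNIV)))"
    using alg unfolding sgsl_cd_def by blast
  then show ?thesis
    unfolding indep_set_def
    by (rule indep_sets_mono_sets) (use sgsl_cd_subset_history in \<open>auto split: bool.split\<close>)
qed

lemma sgsl_cd_subalgebra: "subalgebra P (vimage_algebra (space P) (lam k) borel)"
proof -
  interpret prob_space P using alg unfolding sgsl_cd_def by blast
  show ?thesis using indep_setD_ev1[OF sgsl_cd_node_indep] by (auto simp: subalgebra_def)
qed

lemma sgsl_cd_function_of_iterate:
  fixes \<phi> :: "real^'e \<Rightarrow> real"
  shows "(\<lambda>\<omega>. \<phi> (lam k \<omega>)) \<in> borel_measurable (vimage_algebra (space P) (lam k) borel)"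
    and "integrable P (\<lambda>\<omega>. \<phi> (lam k \<omega>))"
proof -
  interpret prob_space P using alg unfolding sgsl_cd_def by blast
  show meas: "(\<lambda>\<omega>. \<phi> (lam k \<omega>)) \<in> borel_measurable (vimage_algebra (space P) (lam k) borel)"
    by (rule measurable_vimage_algebra_comp_finite_range[OF sgsl_cd_finite_range]) simp
  have "finite ((\<lambda>x. \<bar>\<phi> x\<bar>) ` lam k ` space P)" using sgsl_cd_finite_range by simp
  then show "integrable P (\<lambda>\<omega>. \<phi> (lam k \<omega>))"
    by (intro integrable_const_bound[of _ "Max ((\<lambda>x. \<bar>\<phi> x\<bar>) ` lam k ` space P)"]
        measurable_from_subalg[OF sgsl_cd_subalgebra meas] AE_I2) auto
qed

text \<open>
  A decrease that depends on the iterate and on the drawn node only. The edge is eliminated before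
  expectations are taken, since for a random tie-breaking rule its conditional law is unknown.
\<close>

lemma sgsl_cd_expected_decrease:
  assumes dec: "\<And>\<omega>. \<omega> \<in> space P \<Longrightarrow> F (lam (Suc k) \<omega>) \<le> F (lam k \<omega>) - d (lam k \<omega>) (node k \<omega>)"
  shows "AE \<omega> in P. real_cond_exp P (vimage_algebra (space P) (lam k) borel) (\<lambda>\<omega>. F (lam (Suc k) \<omega>)) \<omega>
    \<le> F (lam k \<omega>) - (\<Sum>i\<in>UNIV. d (lam k \<omega>) i) / CARD('v)"
proof -
  interpret prob_space P using alg unfolding sgsl_cd_def by blast
  let ?G = "vimage_algebra (space P) (lam k) borel"
  interpret G: finite_measure_subalgebra P ?G
    by standard (rule sgsl_cd_subalgebra)
  let ?\<Phi> = "\<lambda>i \<omega>. F (lam k \<omega>) - d (lam k \<omega>) i"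
  have node: "node k \<in> P \<rightarrow>\<^sub>M count_space UNIV"
      "distr P (count_space UNIV) (node k) = uniform_count_measure UNIV"
    using alg unfolding sgsl_cd_def by blast+
  note uniform = real_cond_exp_uniform_choice[OF sgsl_cd_subalgebra node sgsl_cd_node_indep,
      of ?\<Phi>, OF sgsl_cd_function_of_iterate]
  have "AE \<omega> in P. real_cond_exp P ?G (\<lambda>\<omega>. F (lam (Suc k) \<omega>)) \<omega>
      \<le> real_cond_exp P ?G (\<lambda>\<omega>. ?\<Phi> (node k \<omega>) \<omega>) \<omega>"
    by (rule G.real_cond_exp_mono)
       (use dec in \<open>auto intro!: sgsl_cd_function_of_iterate(2) uniform(2)\<close>)
  with uniform(1) show ?thesis
    by eventually_elim (simp add: sum_subtractf diff_divide_distrib)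
qed

end

section \<open>Convergence rate\<close>

theorem theorem6:
  fixes ends :: "'e::finite \<Rightarrow> 'v::finite set"
    and A :: "real^'e^'v"
    and f :: "'v \<Rightarrow> real \<Rightarrow> real"
    and Ms \<mu> :: "'v \<Rightarrow> real"
    and Lc :: "'e \<Rightarrow> real"
    and F :: "real^'e \<Rightarrow> real"
    and S :: "'v \<Rightarrow> 'e set"
    and L \<sigma>_SM \<sigma>_SML :: real
    and lam_opt lam0 :: "real^'e"
    and P :: "'a measure"
    and node :: "nat \<Rightarrow> 'a \<Rightarrow> 'v"
    and edge :: "nat \<Rightarrow> 'a \<Rightarrow> 'e"
    and lam :: "nat \<Rightarrow> 'a \<Rightarrow> real^'e"
  defines "F \<equiv> dual_objective f A"
    and "S \<equiv> incident_edges ends"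
    and "L \<equiv> smoothness_const A \<mu>"
    and "\<sigma>_SM \<equiv> strong_convexity_const F (dual_norm (norm_SM S))"
    and "\<sigma>_SML \<equiv> strong_convexity_const F (dual_norm (norm_SML S Lc))"
  assumes "is_incidence_matrix ends A"
    and "\<And>i. smooth_strongly_convex (Ms i) (\<mu> i) (f i)"
    and "coordinatewise_smooth Lc F"
    and "\<And>l. Lc l \<le> L"
    and "\<And>x. F lam_opt \<le> F x"
    and "sgsl_cd P S Lc F lam0 node edge lam"
  shows "(\<forall>k. AE \<omega> in P.
            real_cond_exp P (vimage_algebra (space P) (lam k) borel) (\<lambda>\<omega>. F (lam (Suc k) \<omega>)) \<omega>
              - F lam_opt
            \<le> (1 - \<sigma>_SML / real CARD('v)) * (F (lam k \<omega>) - F lam_opt))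
         \<and> \<sigma>_SM / L \<le> \<sigma>_SML"
proof -
  note inc = assms(6) and f = assms(7) and smooth = assms(8) and Lc_le = assms(9)
    and opt = assms(10) and alg = assms(11)
  have Lc_pos: "0 < Lc l" for l
    by (rule coordinate_constant_pos[OF f inc smooth[unfolded F_def]])
  have L_pos: "0 < L" using Lc_pos Lc_le by (rule less_le_trans)
  have cover: "\<exists>i. l \<in> S i" for l
    using inc unfolding is_incidence_matrix_def S_def incident_edges_def by blast
  have convex: "F x + grad F x \<bullet> (y - x) \<le> F y" for x y
    unfolding F_def by (rule dual_objective_convex[OF f])
  have line: "((\<lambda>s. F (x + s *\<^sub>R axis l 1)) has_real_derivative
      partial_deriv l F (x + t *\<^sub>R axis l 1)) (at t)" for x l t
    unfolding F_def partial_deriv_dual_objective[where f = f, OF f]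
    by (rule dual_objective_line_derivative[where f = f, OF f])
  have gauge_w: "coordinate_gauge (norm_SML S Lc) (\<Sum>l\<in>UNIV. sqrt (Lc l))"
    using Lc_pos cover by (rule coordinate_gauge_norm_SML)
  have gauge_1: "coordinate_gauge (norm_SM S) (\<Sum>l\<in>(UNIV::'e set). sqrt 1)"
    unfolding norm_SM_eq_norm_SML
    using cover by (intro coordinate_gauge_norm_SML[where Lc = "\<lambda>_. 1"]) auto

  have update: "if S (node k \<omega>) = {} then lam (Suc k) \<omega> = lam k \<omega>
      else is_arg_max (\<lambda>m. \<bar>partial_deriv m F (lam k \<omega>)\<bar> / sqrt (Lc m))
             (\<lambda>m. m \<in> S (node k \<omega>)) (edge k \<omega>) \<and>
           lam (Suc k) \<omega> = lam k \<omega> -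
             (1 / Lc (edge k \<omega>) * partial_deriv (edge k \<omega>) F (lam k \<omega>)) *\<^sub>R axis (edge k \<omega>) 1"
    if "\<omega> \<in> space P" for k \<omega>
    using alg that unfolding sgsl_cd_def by blast
  have decrease: "F (lam (Suc k) \<omega>) \<le> F (lam k \<omega>)
      - nodewise_max S Lc (grad F (lam k \<omega>)) (node k \<omega>) / 2" if \<omega>: "\<omega> \<in> space P" for k \<omega>
  proof (cases "S (node k \<omega>) = {}")
    case True
    then have "lam (Suc k) \<omega> = lam k \<omega>" using update[OF \<omega>, of k] by simp
    with True show ?thesis by (simp add: nodewise_max_def)
  next
    case False
    let ?x = "lam k \<omega>" and ?l = "edge k \<omega>"
    let ?score = "\<lambda>m. \<bar>partial_deriv m F ?x\<bar> / sqrt (Lc m)"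
    have sel: "is_arg_max ?score (\<lambda>m. m \<in> S (node k \<omega>)) ?l"
      and step: "lam (Suc k) \<omega> = ?x - (1 / Lc ?l * partial_deriv ?l F ?x) *\<^sub>R axis ?l 1"
      using update[OF \<omega>, of k] False by simp_all
    have score: "(?score m)\<^sup>2 = 1 / Lc m * (grad F ?x $ m)\<^sup>2" for m
      using Lc_pos[of m] by (simp add: grad_def power_divide)
    obtain m where m: "m \<in> S (node k \<omega>)"
        "nodewise_max S Lc (grad F ?x) (node k \<omega>) = 1 / Lc m * (grad F ?x $ m)\<^sup>2"
      using False by (rule nodewise_max_attained)
    have "?score m \<le> ?score ?l" using sel m(1) unfolding is_arg_max_linorder by blast
    then have "(?score m)\<^sup>2 \<le> (?score ?l)\<^sup>2"
      using Lc_pos[of m] by (intro power_mono) auto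
    then have "nodewise_max S Lc (grad F ?x) (node k \<omega>) \<le> 1 / Lc ?l * (partial_deriv ?l F ?x)\<^sup>2"
      unfolding score m(2) by (simp add: grad_def)
    then have "F ?x - 1 / Lc ?l * (partial_deriv ?l F ?x)\<^sup>2 / 2
        \<le> F ?x - nodewise_max S Lc (grad F ?x) (node k \<omega>) / 2"
      by (intro diff_left_mono divide_right_mono) simp_all
    moreover have "F (lam (Suc k) \<omega>) \<le> F ?x - 1 / Lc ?l * (partial_deriv ?l F ?x)\<^sup>2 / 2"
      unfolding step by (rule coordinate_descent_step[OF smooth Lc_pos line])
    ultimately show ?thesis by (rule order_trans[rotated])
  qed

  have contraction: "F x - (\<Sum>i\<in>UNIV. nodewise_max S Lc (grad F x) i / 2) / CARD('v) - F lam_opt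
      \<le> (1 - \<sigma>_SML / CARD('v)) * (F x - F lam_opt)" for x
  proof -
    have "2 * \<sigma>_SML * (F x - F lam_opt) \<le> (norm_SML S Lc (grad F x))\<^sup>2"
      unfolding \<sigma>_SML_def by (rule coordinate_gauge.gradient_dominance[OF gauge_w convex opt])
    then have "\<sigma>_SML * (F x - F lam_opt) \<le> (\<Sum>i\<in>UNIV. nodewise_max S Lc (grad F x) i / 2)"
      unfolding norm_SML_power2[OF Lc_pos] by (simp flip: sum_divide_distrib)
    then have "\<sigma>_SML * (F x - F lam_opt) / CARD('v)
        \<le> (\<Sum>i\<in>UNIV. nodewise_max S Lc (grad F x) i / 2) / CARD('v)"
      by (rule divide_right_mono) simp
    then show ?thesis by (simp add: left_diff_distrib)
  qed

  have "AE \<omega> in P. real_cond_exp P (vimage_algebra (space P) (lam k) borel)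
      (\<lambda>\<omega>. F (lam (Suc k) \<omega>)) \<omega> - F lam_opt
      \<le> (1 - \<sigma>_SML / CARD('v)) * (F (lam k \<omega>) - F lam_opt)" for k
  proof -
    have "AE \<omega> in P. real_cond_exp P (vimage_algebra (space P) (lam k) borel)
        (\<lambda>\<omega>. F (lam (Suc k) \<omega>)) \<omega>
        \<le> F (lam k \<omega>) - (\<Sum>i\<in>UNIV. nodewise_max S Lc (grad F (lam k \<omega>)) i / 2) / CARD('v)"
      by (rule sgsl_cd_expected_decrease[OF alg]) (rule decrease)
    then show ?thesis
    proof eventually_elim
      case (elim \<omega>)
      then show ?case using contraction[of "lam k \<omega>"] by linarith
    qed
  qed
  moreover have "\<sigma>_SM / L \<le> \<sigma>_SML"
    unfolding \<sigma>_SM_def \<sigma>_SML_def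
    using gauge_1 gauge_w norm_SM_le_norm_SML[OF Lc_pos Lc_le L_pos] L_pos convex
    by (rule strong_convexity_const_le_if_gauge_le)
  ultimately show ?thesis by blast
qed

end
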